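(* Let $p:\widetilde{\mathcal W}\to\mathcal W$ and $p':\widetilde{\mathcal W}'\to\mathcal W$ be coverings of a $2$-Weyl graph $\mathcal W$ of type $M$. Let $\lambda:\bar p\to\bar p'$ be a morphism of groupoid coverings, that is, a groupoid homomorphism $\lambda:\overline{\widetilde{\mathcal W}}\to\overline{\widetilde{\mathcal W}'}$ with $\bar p=\bar p'\circ\lambda$. Then there exists a unique morphism of coverings $\mu:p\to p'$ such that $\bar\mu=\lambda$.
   Context: Setting. $M=(m_{st})_{s,t\in S}$ is a Coxeter matrix on a finite set $S$, and $W=\langle S\mid (st)^{m_{st}}=1,\ m_{st}<\infty\rangle$ is its Coxeter group. A word over $S$ is reduced if no shorter word represents the same element of $W$. For $s\ne t$ let $p_m(s,t)=stst\cdots$ ($m$ letters), and if $m_{st}<\infty$ let $p(s,t)=p_{m_{st}}(s,t)$. Groupoids are small and non-empty, with composition $g;h$ (or $gh$) written left to right, defined when $\tau(g)=\iota(h)$, where $\iota,\tau$ denote initial and terminal vertices. Weyl data. A generalized chamber system $\mathcal W$ of type $M$ is a set $\mathcal W_0$ of chambers with a family of groupoids $(\mathcal W_s)_{s\in S}$ (panel groupoids), each with vertex set $\mathcal W_0$. An edge of $\mathcal W$ of type $s$ is a non-identity edge of $\mathcal W_s$ (edges of different types are distinct). An $s$-panel is a connected component of $\mathcal W_s$. A gallery $\beta$ is a finite sequence of consecutive edges (a trivial gallery is a single chamber with no edges), with initial chamber $\iota(\beta)$, terminal chamber $\tau(\beta)$, type $\beta_S$ (the word of types of its edges), and $W$-length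 $\beta_W\in W$ (the element represented by $\beta_S$). It is a cycle if $\iota(\beta)=\tau(\beta)$, and a geodesic if $\beta_S$ is reduced. For $s\neq t$ with $m_{st}<\infty$: an $(s,t)$-geodesic is a geodesic of type $p_m(s,t)$ for some $m$; a maximal $(s,t)$-geodesic is a gallery of type $p(s,t)$; an $(s,t)$-cycle is a cycle of type $p_{2m_{st}}(s,t)$. An alternating geodesic is an $(s,t)$-geodesic for some $s,t$; trivial galleries and one-edge galleries count as alternating geodesics. Weyl data of type $M$ is a generalized chamber system of type $M$ together with, for each ordered pair $(s,t)$ with $s\neq t$, $m_{st}<\infty$, a set of $(s,t)$-cycles called defining suites. Homotopy. Elementary homotopies of galleries are the following moves on subgalleries and their inverses: delete $i\,i^{-1}$; replace $i\,i'$ ($i,i'$ of the same type, $i'\ne i^{-1}$) by the single edge $i;i'$; delete a defining suite. Galleries are homotopic ($\sim$) if related by finitely many such moves. A suite is an $(s,t)$-cycle homotopic to a trivial gallery. The fundamental groupoid $\overline{\mathcal W}$ has vertices the chambers and edges the homotopy classes $[\beta]$ of galleries, with $[\beta];[\beta']=[\beta\beta']$. A morphism $\omega$ of Weyl data induces the groupoid homomorphism $\bar\omega:[\beta]\mapsto[\omega\circ\beta]$. Morphisms and coverings. A morphism of generalized chamber systems of type $M$ is a map on chambers and edges preserving extremities, types and inverses, with $\omega(i;i')=\omega(i);\omega(i')$ whenever $i,i'$ are composable of the same type and $i'\neq i^{-1}$. A morphism of Weyl data is such a morphism sending defining suites to suites. A morphism is surjective-étale if it is surjective on chambers and, for every chamber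 $C$, restricts to a bijection from the edges issuing from $C$ to the edges issuing from the image of $C$. A covering $p:\widetilde{\mathcal W}\to\mathcal W$ of Weyl data is a surjective-étale morphism of Weyl data such that every gallery $\beta$ of $\widetilde{\mathcal W}$ with $p\circ\beta$ a defining suite of $\mathcal W$ is a suite of $\widetilde{\mathcal W}$. A morphism of coverings $\mu:p\to p'$ is a morphism of Weyl data $\mu:\widetilde{\mathcal W}\to\widetilde{\mathcal W}'$ with $p=p'\circ\mu$. A pre-Weyl graph is Weyl data satisfying (PW0) no panel is a trivial groupoid (one vertex, one edge), and (PW1) each maximal $(s,t)$-geodesic is homotopic to a maximal $(t,s)$-geodesic. A $2$-Weyl graph is a pre-Weyl graph satisfying (2W) homotopic alternating geodesics have the same $W$-length. *)

theory Defs
  imports "HOL-Algebra.Group" "HOL-Library.Extended_Nat" "HOL-Library.FuncSet"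
begin

section \<open>Groups given by a presentation\<close>

text \<open>Letters are signed generators: \<open>(g, True)\<close> stands for \<open>g\<close> and \<open>(g, False)\<close> for its
  formal inverse.\<close>

inductive pres_step :: "'g set \<Rightarrow> ('g \<times> bool) list set \<Rightarrow> ('g \<times> bool) list \<Rightarrow> ('g \<times> bool) list \<Rightarrow> bool"
  for X :: "'g set" and R :: "('g \<times> bool) list set" where
  cancel: "\<lbrakk>u \<in> lists (X \<times> UNIV); v \<in> lists (X \<times> UNIV); g \<in> X\<rbrakk>
    \<Longrightarrow> pres_step X R (u @ [(g, b), (g, \<not> b)] @ v) (u @ v)"
| relator: "\<lbrakk>u \<in> lists (X \<times> UNIV); v \<in> lists (X \<times> UNIV); r \<in> R\<rbrakk>
    \<Longrightarrow> pres_step X R (u @ r @ v) (u @ v)"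

definition pres_rel :: "'g set \<Rightarrow> ('g \<times> bool) list set \<Rightarrow> (('g \<times> bool) list \<times> ('g \<times> bool) list) set"
  where "pres_rel X R =
    {(u, v). u \<in> lists (X \<times> UNIV) \<and> v \<in> lists (X \<times> UNIV) \<and> equivclp (pres_step X R) u v}"

definition presented_group :: "'g set \<Rightarrow> ('g \<times> bool) list set \<Rightarrow> ('g \<times> bool) list set monoid"
  where "presented_group X R =
    \<lparr>carrier = lists (X \<times> UNIV) // pres_rel X R,
     mult = (\<lambda>A B. \<Union>a\<in>A. \<Union>b\<in>B. pres_rel X R `` {a @ b}),
     one = pres_rel X R `` {[]}\<rparr>"


section \<open>Coxeter groups\<close>

record 's coxmat =
  gens :: "'s set"
  entry :: "'s \<Rightarrow> 's \<Rightarrow> enat"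

definition coxeter_matrix :: "'s coxmat \<Rightarrow> bool" where
  "coxeter_matrix M \<longleftrightarrow> finite (gens M) \<and>
    (\<forall>s\<in>gens M. entry M s s = 1) \<and>
    (\<forall>s\<in>gens M. \<forall>t\<in>gens M. s \<noteq> t \<longrightarrow> entry M s t \<ge> 2 \<and> entry M s t = entry M t s)"

definition coxeter_relators :: "'s coxmat \<Rightarrow> ('s \<times> bool) list set" where
  "coxeter_relators M =
    {concat (replicate (the_enat (entry M s t)) [(s, True), (t, True)]) | s t.
      s \<in> gens M \<and> t \<in> gens M \<and> entry M s t < \<infinity>}"

definition coxeter_group :: "'s coxmat \<Rightarrow> ('s \<times> bool) list set monoid" where
  "coxeter_group M = presented_group (gens M) (coxeter_relators M)"

definition coxeter_gen :: "'s coxmat \<Rightarrow> 's \<Rightarrow> ('s \<times> bool) list set" where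
  "coxeter_gen M s = pres_rel (gens M) (coxeter_relators M) `` {[(s, True)]}"

definition word_elt :: "'s coxmat \<Rightarrow> 's list \<Rightarrow> ('s \<times> bool) list set" where
  "word_elt M w =
    foldr (\<lambda>s x. coxeter_gen M s \<otimes>\<^bsub>coxeter_group M\<^esub> x) w \<one>\<^bsub>coxeter_group M\<^esub>"

definition reduced :: "'s coxmat \<Rightarrow> 's list \<Rightarrow> bool" where
  "reduced M w \<longleftrightarrow> w \<in> lists (gens M) \<and>
    (\<forall>v\<in>lists (gens M). word_elt M v = word_elt M w \<longrightarrow> length w \<le> length v)"

text \<open>The word \<open>stst\<dots>\<close> with \<open>n\<close> letters.\<close>

fun alt_word :: "nat \<Rightarrow> 's \<Rightarrow> 's \<Rightarrow> 's list" where
  "alt_word 0 s t = []"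
| "alt_word (Suc n) s t = s # alt_word n t s"

definition finite_pair :: "'s coxmat \<Rightarrow> 's \<Rightarrow> 's \<Rightarrow> bool" where
  "finite_pair M s t \<longleftrightarrow> s \<in> gens M \<and> t \<in> gens M \<and> s \<noteq> t \<and> entry M s t < \<infinity>"


section \<open>Groupoids\<close>

record ('v, 'e) groupoid_data =
  verts :: "'v set"
  edges :: "'e set"
  src :: "'e \<Rightarrow> 'v"
  tgt :: "'e \<Rightarrow> 'v"
  gcomp :: "'e \<Rightarrow> 'e \<Rightarrow> 'e"
  gid :: "'v \<Rightarrow> 'e"
  ginv :: "'e \<Rightarrow> 'e"

text \<open>Composition is written left to right: \<open>gcomp G g h\<close> is meaningful when
  \<open>tgt G g = src G h\<close>.\<close>

locale groupoid =
  fixes G :: "('v, 'e) groupoid_data"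
  assumes verts_nonempty: "verts G \<noteq> {}"
    and src_closed: "g \<in> edges G \<Longrightarrow> src G g \<in> verts G"
    and tgt_closed: "g \<in> edges G \<Longrightarrow> tgt G g \<in> verts G"
    and comp_closed: "\<lbrakk>g \<in> edges G; h \<in> edges G; tgt G g = src G h\<rbrakk> \<Longrightarrow> gcomp G g h \<in> edges G"
    and src_comp: "\<lbrakk>g \<in> edges G; h \<in> edges G; tgt G g = src G h\<rbrakk> \<Longrightarrow> src G (gcomp G g h) = src G g"
    and tgt_comp: "\<lbrakk>g \<in> edges G; h \<in> edges G; tgt G g = src G h\<rbrakk> \<Longrightarrow> tgt G (gcomp G g h) = tgt G h"
    and comp_assoc: "\<lbrakk>g \<in> edges G; h \<in> edges G; k \<in> edges G; tgt G g = src G h; tgt G h = src G k\<rbrakk>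
      \<Longrightarrow> gcomp G (gcomp G g h) k = gcomp G g (gcomp G h k)"
    and id_closed: "x \<in> verts G \<Longrightarrow> gid G x \<in> edges G"
    and src_id: "x \<in> verts G \<Longrightarrow> src G (gid G x) = x"
    and tgt_id: "x \<in> verts G \<Longrightarrow> tgt G (gid G x) = x"
    and id_left: "g \<in> edges G \<Longrightarrow> gcomp G (gid G (src G g)) g = g"
    and id_right: "g \<in> edges G \<Longrightarrow> gcomp G g (gid G (tgt G g)) = g"
    and inv_closed: "g \<in> edges G \<Longrightarrow> ginv G g \<in> edges G"
    and src_inv: "g \<in> edges G \<Longrightarrow> src G (ginv G g) = tgt G g"
    and tgt_inv: "g \<in> edges G \<Longrightarrow> tgt G (ginv G g) = src G g"
    and inv_right: "g \<in> edges G \<Longrightarrow> gcomp G g (ginv G g) = gid G (src G g)"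
    and inv_left: "g \<in> edges G \<Longrightarrow> gcomp G (ginv G g) g = gid G (tgt G g)"

definition component :: "('v, 'e) groupoid_data \<Rightarrow> 'v \<Rightarrow> ('v, 'e) groupoid_data" where
  "component G x = G\<lparr>
     verts := {y \<in> verts G. \<exists>g\<in>edges G. src G g = x \<and> tgt G g = y},
     edges := {h \<in> edges G. \<exists>g\<in>edges G. src G g = x \<and> tgt G g = src G h}\<rparr>"

definition trivial_groupoid :: "('v, 'e) groupoid_data \<Rightarrow> bool" where
  "trivial_groupoid G \<longleftrightarrow> is_singleton (verts G) \<and> is_singleton (edges G)"

text \<open>Maps on vertices and edges.  All maps below are extensional (\<open>undefined\<close> off their
  domain), so that HOL equality of such maps is equality of maps on the given sets.\<close>

datatype ('v, 'v2, 'e, 'e2) graph_map = Graph_Map (vmap: "'v \<Rightarrow> 'v2") (emap: "'e \<Rightarrow> 'e2")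

text \<open>The composite \<open>f\<close> followed by \<open>g\<close>, for \<open>f\<close> defined on vertex set \<open>V\<close> and edge set \<open>E\<close>.\<close>

definition map_comp_on ::
  "'v set \<Rightarrow> 'e set \<Rightarrow> ('v2, 'v3, 'e2, 'e3) graph_map \<Rightarrow> ('v, 'v2, 'e, 'e2) graph_map
    \<Rightarrow> ('v, 'v3, 'e, 'e3) graph_map" where
  "map_comp_on V E g f = Graph_Map (compose V (vmap g) (vmap f)) (compose E (emap g) (emap f))"

definition groupoid_hom ::
  "('v, 'e) groupoid_data \<Rightarrow> ('v2, 'e2) groupoid_data \<Rightarrow> ('v, 'v2, 'e, 'e2) graph_map \<Rightarrow> bool" where
  "groupoid_hom G H f \<longleftrightarrow>
    vmap f \<in> verts G \<rightarrow>\<^sub>E verts H \<and> emap f \<in> edges G \<rightarrow>\<^sub>E edges H \<and>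
    (\<forall>g\<in>edges G. src H (emap f g) = vmap f (src G g) \<and> tgt H (emap f g) = vmap f (tgt G g)) \<and>
    (\<forall>x\<in>verts G. emap f (gid G x) = gid H (vmap f x)) \<and>
    (\<forall>g\<in>edges G. \<forall>h\<in>edges G. tgt G g = src G h \<longrightarrow>
      emap f (gcomp G g h) = gcomp H (emap f g) (emap f h))"


section \<open>Generalized chamber systems and galleries\<close>

record ('s, 'c, 'e) chamber_data =
  chambers :: "'c set"
  panel_groupoid :: "'s \<Rightarrow> ('c, 'e) groupoid_data"

text \<open>An edge of type \<open>s\<close> is tagged by its type, so edges of different types are distinct.\<close>

type_synonym ('s, 'e) cedge = "'s \<times> 'e"

definition cedges :: "'s coxmat \<Rightarrow> ('s, 'c, 'e, 'z) chamber_data_scheme \<Rightarrow> ('s, 'e) cedge set" where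
  "cedges M W = {(s, e). s \<in> gens M \<and>
    e \<in> edges (panel_groupoid W s) - gid (panel_groupoid W s) ` verts (panel_groupoid W s)}"

definition csrc :: "('s, 'c, 'e, 'z) chamber_data_scheme \<Rightarrow> ('s, 'e) cedge \<Rightarrow> 'c" where
  "csrc W i = src (panel_groupoid W (fst i)) (snd i)"

definition ctgt :: "('s, 'c, 'e, 'z) chamber_data_scheme \<Rightarrow> ('s, 'e) cedge \<Rightarrow> 'c" where
  "ctgt W i = tgt (panel_groupoid W (fst i)) (snd i)"

definition cinv :: "('s, 'c, 'e, 'z) chamber_data_scheme \<Rightarrow> ('s, 'e) cedge \<Rightarrow> ('s, 'e) cedge" where
  "cinv W i = (fst i, ginv (panel_groupoid W (fst i)) (snd i))"

text \<open>The pairs \<open>(i, j)\<close> of edges of the same type whose composite is again an edge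
  (that is, not an identity), and the composite.\<close>

definition ccomposable ::
  "'s coxmat \<Rightarrow> ('s, 'c, 'e, 'z) chamber_data_scheme \<Rightarrow> ('s, 'e) cedge \<Rightarrow> ('s, 'e) cedge \<Rightarrow> bool" where
  "ccomposable M W i j \<longleftrightarrow> i \<in> cedges M W \<and> j \<in> cedges M W \<and>
    fst i = fst j \<and> ctgt W i = csrc W j \<and> j \<noteq> cinv W i"

definition ccomp ::
  "('s, 'c, 'e, 'z) chamber_data_scheme \<Rightarrow> ('s, 'e) cedge \<Rightarrow> ('s, 'e) cedge \<Rightarrow> ('s, 'e) cedge" where
  "ccomp W i j = (fst i, gcomp (panel_groupoid W (fst i)) (snd i) (snd j))"

text \<open>Non-emptiness of the set of chambers is explicit because it does not follow from the
  panel groupoids when there are no generators.\<close>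

definition generalized_chamber_system ::
  "'s coxmat \<Rightarrow> ('s, 'c, 'e, 'z) chamber_data_scheme \<Rightarrow> bool" where
  "generalized_chamber_system M W \<longleftrightarrow> chambers W \<noteq> {} \<and>
    (\<forall>s\<in>gens M. groupoid (panel_groupoid W s) \<and> verts (panel_groupoid W s) = chambers W)"

definition panels :: "('s, 'c, 'e, 'z) chamber_data_scheme \<Rightarrow> 's \<Rightarrow> ('c, 'e) groupoid_data set" where
  "panels W s = component (panel_groupoid W s) ` verts (panel_groupoid W s)"

text \<open>A gallery is recorded as its initial chamber together with its list of edges.\<close>

type_synonym ('s, 'c, 'e) gal = "'c \<times> ('s, 'e) cedge list"

primrec gallery_from ::
  "'s coxmat \<Rightarrow> ('s, 'c, 'e, 'z) chamber_data_scheme \<Rightarrow> ('s, 'e) cedge list \<Rightarrow> 'c \<Rightarrow> bool" where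
  "gallery_from M W [] C \<longleftrightarrow> C \<in> chambers W"
| "gallery_from M W (i # is) C \<longleftrightarrow>
    i \<in> cedges M W \<and> csrc W i = C \<and> gallery_from M W is (ctgt W i)"

definition gallery :: "'s coxmat \<Rightarrow> ('s, 'c, 'e, 'z) chamber_data_scheme \<Rightarrow> ('s, 'c, 'e) gal \<Rightarrow> bool" where
  "gallery M W \<beta> \<longleftrightarrow> gallery_from M W (snd \<beta>) (fst \<beta>)"

definition gstart :: "('s, 'c, 'e) gal \<Rightarrow> 'c" where
  "gstart \<beta> = fst \<beta>"

definition gend :: "('s, 'c, 'e, 'z) chamber_data_scheme \<Rightarrow> ('s, 'c, 'e) gal \<Rightarrow> 'c" where
  "gend W \<beta> = (if snd \<beta> = [] then fst \<beta> else ctgt W (last (snd \<beta>)))"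

definition gappend :: "('s, 'c, 'e) gal \<Rightarrow> ('s, 'c, 'e) gal \<Rightarrow> ('s, 'c, 'e) gal" where
  "gappend \<beta> \<gamma> = (fst \<beta>, snd \<beta> @ snd \<gamma>)"

definition greverse ::
  "('s, 'c, 'e, 'z) chamber_data_scheme \<Rightarrow> ('s, 'c, 'e) gal \<Rightarrow> ('s, 'c, 'e) gal" where
  "greverse W \<beta> = (gend W \<beta>, rev (map (cinv W) (snd \<beta>)))"

definition gtype :: "('s, 'c, 'e) gal \<Rightarrow> 's list" where
  "gtype \<beta> = map fst (snd \<beta>)"

definition wlength :: "'s coxmat \<Rightarrow> ('s, 'c, 'e) gal \<Rightarrow> ('s \<times> bool) list set" where
  "wlength M \<beta> = word_elt M (gtype \<beta>)"

definition cycle :: "'s coxmat \<Rightarrow> ('s, 'c, 'e, 'z) chamber_data_scheme \<Rightarrow> ('s, 'c, 'e) gal \<Rightarrow> bool" where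
  "cycle M W \<beta> \<longleftrightarrow> gallery M W \<beta> \<and> gstart \<beta> = gend W \<beta>"

definition geodesic :: "'s coxmat \<Rightarrow> ('s, 'c, 'e, 'z) chamber_data_scheme \<Rightarrow> ('s, 'c, 'e) gal \<Rightarrow> bool" where
  "geodesic M W \<beta> \<longleftrightarrow> gallery M W \<beta> \<and> reduced M (gtype \<beta>)"

definition st_geodesic ::
  "'s coxmat \<Rightarrow> ('s, 'c, 'e, 'z) chamber_data_scheme \<Rightarrow> 's \<Rightarrow> 's \<Rightarrow> ('s, 'c, 'e) gal \<Rightarrow> bool" where
  "st_geodesic M W s t \<beta> \<longleftrightarrow> finite_pair M s t \<and> geodesic M W \<beta> \<and> (\<exists>n. gtype \<beta> = alt_word n s t)"

definition max_st_geodesic ::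
  "'s coxmat \<Rightarrow> ('s, 'c, 'e, 'z) chamber_data_scheme \<Rightarrow> 's \<Rightarrow> 's \<Rightarrow> ('s, 'c, 'e) gal \<Rightarrow> bool" where
  "max_st_geodesic M W s t \<beta> \<longleftrightarrow> finite_pair M s t \<and> gallery M W \<beta> \<and>
    gtype \<beta> = alt_word (the_enat (entry M s t)) s t"

definition st_cycle ::
  "'s coxmat \<Rightarrow> ('s, 'c, 'e, 'z) chamber_data_scheme \<Rightarrow> 's \<Rightarrow> 's \<Rightarrow> ('s, 'c, 'e) gal \<Rightarrow> bool" where
  "st_cycle M W s t \<beta> \<longleftrightarrow> finite_pair M s t \<and> cycle M W \<beta> \<and>
    gtype \<beta> = alt_word (2 * the_enat (entry M s t)) s t"

text \<open>The last disjunct is not redundant: an edge of type \<open>s\<close> need not be an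
  \<open>(s,t)\<close>-geodesic, as there may be no \<open>t \<noteq> s\<close> with \<open>m\<^sub>s\<^sub>t < \<infinity>\<close>.\<close>

definition alternating_geodesic ::
  "'s coxmat \<Rightarrow> ('s, 'c, 'e, 'z) chamber_data_scheme \<Rightarrow> ('s, 'c, 'e) gal \<Rightarrow> bool" where
  "alternating_geodesic M W \<beta> \<longleftrightarrow>
    (\<exists>s t. st_geodesic M W s t \<beta>) \<or> (gallery M W \<beta> \<and> length (snd \<beta>) \<le> 1)"


section \<open>Weyl data and homotopy\<close>

record ('s, 'c, 'e) weyl_data_rec = "('s, 'c, 'e) chamber_data" +
  st_suites :: "'s \<Rightarrow> 's \<Rightarrow> ('s, 'c, 'e) gal set"

definition weyl_data :: "'s coxmat \<Rightarrow> ('s, 'c, 'e) weyl_data_rec \<Rightarrow> bool" where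
  "weyl_data M W \<longleftrightarrow> generalized_chamber_system M W \<and>
    (\<forall>s t. finite_pair M s t \<longrightarrow> (\<forall>\<beta>\<in>st_suites W s t. st_cycle M W s t \<beta>))"

definition defining_suites :: "'s coxmat \<Rightarrow> ('s, 'c, 'e) weyl_data_rec \<Rightarrow> ('s, 'c, 'e) gal set" where
  "defining_suites M W = {\<beta>. \<exists>s t. finite_pair M s t \<and> \<beta> \<in> st_suites W s t}"

inductive elementary_homotopy ::
  "'s coxmat \<Rightarrow> ('s, 'c, 'e) weyl_data_rec \<Rightarrow> ('s, 'c, 'e) gal \<Rightarrow> ('s, 'c, 'e) gal \<Rightarrow> bool"
  for M :: "'s coxmat" and W :: "('s, 'c, 'e) weyl_data_rec" where
  delete_inverse: "gallery M W (C, us @ [i, cinv W i] @ vs)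
    \<Longrightarrow> elementary_homotopy M W (C, us @ [i, cinv W i] @ vs) (C, us @ vs)"
| compose_edges: "\<lbrakk>gallery M W (C, us @ [i, j] @ vs); ccomposable M W i j\<rbrakk>
    \<Longrightarrow> elementary_homotopy M W (C, us @ [i, j] @ vs) (C, us @ [ccomp W i j] @ vs)"
| delete_suite: "\<lbrakk>gallery M W (C, us @ ds @ vs); (D, ds) \<in> defining_suites M W\<rbrakk>
    \<Longrightarrow> elementary_homotopy M W (C, us @ ds @ vs) (C, us @ vs)"

definition homotopic ::
  "'s coxmat \<Rightarrow> ('s, 'c, 'e) weyl_data_rec \<Rightarrow> ('s, 'c, 'e) gal \<Rightarrow> ('s, 'c, 'e) gal \<Rightarrow> bool" where
  "homotopic M W \<beta> \<gamma> \<longleftrightarrow>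
    gallery M W \<beta> \<and> gallery M W \<gamma> \<and> equivclp (elementary_homotopy M W) \<beta> \<gamma>"

definition suite :: "'s coxmat \<Rightarrow> ('s, 'c, 'e) weyl_data_rec \<Rightarrow> ('s, 'c, 'e) gal \<Rightarrow> bool" where
  "suite M W \<beta> \<longleftrightarrow> (\<exists>s t. st_cycle M W s t \<beta>) \<and> (\<exists>C\<in>chambers W. homotopic M W \<beta> (C, []))"

definition hclass ::
  "'s coxmat \<Rightarrow> ('s, 'c, 'e) weyl_data_rec \<Rightarrow> ('s, 'c, 'e) gal \<Rightarrow> ('s, 'c, 'e) gal set" where
  "hclass M W \<beta> = {\<gamma>. homotopic M W \<beta> \<gamma>}"

text \<open>Operations on classes are defined through an arbitrary representative.\<close>

definition hrep :: "('s, 'c, 'e) gal set \<Rightarrow> ('s, 'c, 'e) gal" where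
  "hrep X = (SOME \<beta>. \<beta> \<in> X)"

definition fundamental_groupoid ::
  "'s coxmat \<Rightarrow> ('s, 'c, 'e) weyl_data_rec \<Rightarrow> ('c, ('s, 'c, 'e) gal set) groupoid_data" where
  "fundamental_groupoid M W =
    \<lparr>verts = chambers W,
     edges = {hclass M W \<beta> | \<beta>. gallery M W \<beta>},
     src = (\<lambda>X. gstart (hrep X)),
     tgt = (\<lambda>X. gend W (hrep X)),
     gcomp = (\<lambda>X Y. hclass M W (gappend (hrep X) (hrep Y))),
     gid = (\<lambda>C. hclass M W (C, [])),
     ginv = (\<lambda>X. hclass M W (greverse W (hrep X)))\<rparr>"


section \<open>Morphisms and coverings\<close>

type_synonym ('s, 'c, 'e, 'c2, 'e2) cmap = "('c, 'c2, ('s, 'e) cedge, ('s, 'e2) cedge) graph_map"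

definition map_gallery ::
  "('s, 'c, 'e, 'c2, 'e2) cmap \<Rightarrow> ('s, 'c, 'e) gal \<Rightarrow> ('s, 'c2, 'e2) gal" where
  "map_gallery \<omega> \<beta> = (vmap \<omega> (fst \<beta>), map (emap \<omega>) (snd \<beta>))"

definition chamber_morphism ::
  "'s coxmat \<Rightarrow> ('s, 'c, 'e, 'y) chamber_data_scheme \<Rightarrow> ('s, 'c2, 'e2, 'z) chamber_data_scheme
    \<Rightarrow> ('s, 'c, 'e, 'c2, 'e2) cmap \<Rightarrow> bool" where
  "chamber_morphism M W W' \<omega> \<longleftrightarrow>
    vmap \<omega> \<in> chambers W \<rightarrow>\<^sub>E chambers W' \<and> emap \<omega> \<in> cedges M W \<rightarrow>\<^sub>E cedges M W' \<and>
    (\<forall>i\<in>cedges M W.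
      csrc W' (emap \<omega> i) = vmap \<omega> (csrc W i) \<and>
      ctgt W' (emap \<omega> i) = vmap \<omega> (ctgt W i) \<and>
      fst (emap \<omega> i) = fst i \<and>
      emap \<omega> (cinv W i) = cinv W' (emap \<omega> i)) \<and>
    (\<forall>i j. ccomposable M W i j \<longrightarrow> emap \<omega> (ccomp W i j) = ccomp W' (emap \<omega> i) (emap \<omega> j))"

definition weyl_morphism ::
  "'s coxmat \<Rightarrow> ('s, 'c, 'e) weyl_data_rec \<Rightarrow> ('s, 'c2, 'e2) weyl_data_rec
    \<Rightarrow> ('s, 'c, 'e, 'c2, 'e2) cmap \<Rightarrow> bool" where
  "weyl_morphism M W W' \<omega> \<longleftrightarrow> chamber_morphism M W W' \<omega> \<and>
    (\<forall>\<beta>\<in>defining_suites M W. suite M W' (map_gallery \<omega> \<beta>))"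

definition induced_hom ::
  "'s coxmat \<Rightarrow> ('s, 'c, 'e) weyl_data_rec \<Rightarrow> ('s, 'c2, 'e2) weyl_data_rec
    \<Rightarrow> ('s, 'c, 'e, 'c2, 'e2) cmap
    \<Rightarrow> ('c, 'c2, ('s, 'c, 'e) gal set, ('s, 'c2, 'e2) gal set) graph_map" where
  "induced_hom M W W' \<omega> = Graph_Map
    (restrict (vmap \<omega>) (verts (fundamental_groupoid M W)))
    (restrict (\<lambda>X. hclass M W' (map_gallery \<omega> (hrep X))) (edges (fundamental_groupoid M W)))"

definition surjective_etale ::
  "'s coxmat \<Rightarrow> ('s, 'c, 'e, 'y) chamber_data_scheme \<Rightarrow> ('s, 'c2, 'e2, 'z) chamber_data_scheme
    \<Rightarrow> ('s, 'c, 'e, 'c2, 'e2) cmap \<Rightarrow> bool" where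
  "surjective_etale M W W' \<omega> \<longleftrightarrow> vmap \<omega> ` chambers W = chambers W' \<and>
    (\<forall>C\<in>chambers W. bij_betw (emap \<omega>)
      {i \<in> cedges M W. csrc W i = C} {i \<in> cedges M W'. csrc W' i = vmap \<omega> C})"

definition covering ::
  "'s coxmat \<Rightarrow> ('s, 'c, 'e) weyl_data_rec \<Rightarrow> ('s, 'c2, 'e2) weyl_data_rec
    \<Rightarrow> ('s, 'c, 'e, 'c2, 'e2) cmap \<Rightarrow> bool" where
  "covering M Wt W p \<longleftrightarrow> weyl_data M Wt \<and> weyl_data M W \<and>
    weyl_morphism M Wt W p \<and> surjective_etale M Wt W p \<and>
    (\<forall>\<beta>. gallery M Wt \<beta> \<and> map_gallery p \<beta> \<in> defining_suites M W \<longrightarrow> suite M Wt \<beta>)"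

definition covering_morphism ::
  "'s coxmat \<Rightarrow> ('s, 'c1, 'e1) weyl_data_rec \<Rightarrow> ('s, 'c2, 'e2) weyl_data_rec
    \<Rightarrow> ('s, 'c1, 'e1, 'c, 'e) cmap \<Rightarrow> ('s, 'c2, 'e2, 'c, 'e) cmap
    \<Rightarrow> ('s, 'c1, 'e1, 'c2, 'e2) cmap \<Rightarrow> bool" where
  "covering_morphism M Wt Wt' p p' \<mu> \<longleftrightarrow> weyl_morphism M Wt Wt' \<mu> \<and>
    p = map_comp_on (chambers Wt) (cedges M Wt) p' \<mu>"

definition groupoid_covering_morphism ::
  "('v1, 'e1) groupoid_data \<Rightarrow> ('v2, 'e2) groupoid_data
    \<Rightarrow> ('v1, 'v, 'e1, 'e) graph_map \<Rightarrow> ('v2, 'v, 'e2, 'e) graph_map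
    \<Rightarrow> ('v1, 'v2, 'e1, 'e2) graph_map \<Rightarrow> bool" where
  "groupoid_covering_morphism G G' q q' f \<longleftrightarrow> groupoid_hom G G' f \<and>
    q = map_comp_on (verts G) (edges G) q' f"


section \<open>Weyl graphs\<close>

definition pre_weyl_graph :: "'s coxmat \<Rightarrow> ('s, 'c, 'e) weyl_data_rec \<Rightarrow> bool" where
  "pre_weyl_graph M W \<longleftrightarrow> weyl_data M W \<and>
    (\<forall>s\<in>gens M. \<forall>P\<in>panels W s. \<not> trivial_groupoid P) \<and>
    (\<forall>s t \<beta>. max_st_geodesic M W s t \<beta> \<longrightarrow>
      (\<exists>\<gamma>. max_st_geodesic M W t s \<gamma> \<and> homotopic M W \<beta> \<gamma>))"

definition two_weyl_graph :: "'s coxmat \<Rightarrow> ('s, 'c, 'e) weyl_data_rec \<Rightarrow> bool" where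
  "two_weyl_graph M W \<longleftrightarrow> pre_weyl_graph M W \<and>
    (\<forall>\<beta> \<gamma>. alternating_geodesic M W \<beta> \<longrightarrow> alternating_geodesic M W \<gamma> \<longrightarrow>
      homotopic M W \<beta> \<gamma> \<longrightarrow> wlength M \<beta> = wlength M \<gamma>)"

end

theory Submission
  imports Defs
begin

text \<open>A covering lifts galleries uniquely from a given initial chamber, and the lifts of homotopic
  galleries are homotopic; so a class in the fundamental groupoid of the total space is determined
  by its initial chamber and its image.  Hence the covering morphism must send an edge \<open>i\<close> to the
  unique edge above \<open>p i\<close> issuing from the \<open>\<Lambda>\<close>-image of the initial chamber of \<open>i\<close>; the class of
  that edge is the \<open>\<Lambda>\<close>-image of the class of \<open>i\<close>, which gives its terminal chamber.\<close>

lemma gend_Nil [simp]: "gend W (C, []) = C"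
  by (simp add: gend_def)

text \<open>Replaces the definition through \<open>last\<close> by a recursion parallel to that of
  \<open>gallery_from\<close>, so that inductions over edge lists keep track of the terminal
  chamber.\<close>

lemma gend_Cons [simp]: "gend W (C, i # us) = gend W (ctgt W i, us)"
  by (simp add: gend_def)

lemma gend_append [simp]: "gend W (C, us @ vs) = gend W (gend W (C, us), vs)"
  by (simp add: gend_def)

section \<open>Edges of panel groupoids\<close>

locale weyl_system =
  fixes M :: "'s coxmat" and W :: "('s, 'c, 'e) weyl_data_rec"
  assumes coxeter: "coxeter_matrix M" and weyl: "weyl_data M W"
begin

lemma panel_groupoid: "s \<in> gens M \<Longrightarrow> groupoid (panel_groupoid W s)"
  and panel_verts: "s \<in> gens M \<Longrightarrow> verts (panel_groupoid W s) = chambers W"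
  using weyl by (auto simp: weyl_data_def generalized_chamber_system_def)

lemma csrc_closed [simp]: "i \<in> cedges M W \<Longrightarrow> csrc W i \<in> chambers W"
  and ctgt_closed [simp]: "i \<in> cedges M W \<Longrightarrow> ctgt W i \<in> chambers W"
  using groupoid.src_closed[OF panel_groupoid] groupoid.tgt_closed[OF panel_groupoid] panel_verts
  by (fastforce simp: cedges_def csrc_def ctgt_def)+

lemma csrc_cinv [simp]: "i \<in> cedges M W \<Longrightarrow> csrc W (cinv W i) = ctgt W i"
  and ctgt_cinv [simp]: "i \<in> cedges M W \<Longrightarrow> ctgt W (cinv W i) = csrc W i"
  using groupoid.src_inv[OF panel_groupoid] groupoid.tgt_inv[OF panel_groupoid]
  by (auto simp: cedges_def csrc_def ctgt_def cinv_def)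

lemma cinv_closed [simp]:
  assumes "i \<in> cedges M W"
  shows "cinv W i \<in> cedges M W"
proof -
  obtain s e where i: "i = (s, e)" by force
  define G where "G = panel_groupoid W s"
  have s: "s \<in> gens M" and e: "e \<in> edges G" and ne: "e \<notin> gid G ` verts G"
    using assms by (auto simp: i cedges_def G_def)
  interpret groupoid G using panel_groupoid[OF s] by (simp add: G_def)
  have "ginv G e \<notin> gid G ` verts G"
  proof
    assume "ginv G e \<in> gid G ` verts G"
    then obtain x where x: "x \<in> verts G" "ginv G e = gid G x" by blast
    then have "src G e = x" "tgt G e = x"
      using src_inv[OF e] tgt_inv[OF e] src_id[of x] tgt_id[of x] by auto
    \<comment> \<open>\<open>e\<close> is a loop at \<open>x\<close> whose inverse is the identity,
      so \<open>e\<close> composed with its inverse is both \<open>e\<close> and the identity at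
      \<open>x\<close>.\<close>
    then have "e = gid G x"
      using inv_right[OF e] id_right[OF e] x by simp
    with ne x show False by blast
  qed
  then show ?thesis using s inv_closed[OF e] by (simp add: i cedges_def cinv_def G_def)
qed

text \<open>The right-hand condition is what a chamber morphism can be seen to preserve.\<close>

lemma ccomposable_iff:
  assumes "i \<in> cedges M W" "j \<in> cedges M W" "fst i = fst j" "ctgt W i = csrc W j"
  shows "ccomposable M W i j \<longleftrightarrow> ccomp W i j \<in> cedges M W"
proof -
  obtain s e f where ij: "i = (s, e)" "j = (s, f)" using assms(3) by (metis prod.exhaust fst_conv)
  define G where "G = panel_groupoid W s"
  have s: "s \<in> gens M" and e: "e \<in> edges G" and f: "f \<in> edges G" and t: "tgt G e = src G f"
    using assms by (auto simp: ij cedges_def G_def csrc_def ctgt_def)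
  interpret groupoid G using panel_groupoid[OF s] by (simp add: G_def)
  have "f = ginv G e \<longleftrightarrow> gcomp G e f \<in> gid G ` verts G"
  proof
    assume "f = ginv G e"
    then show "gcomp G e f \<in> gid G ` verts G" using inv_right[OF e] src_closed[OF e] by blast
  next
    assume "gcomp G e f \<in> gid G ` verts G"
    then obtain x where x: "x \<in> verts G" "gcomp G e f = gid G x" by blast
    have "x = src G e" "x = tgt G f"
      using src_comp[OF e f t] tgt_comp[OF e f t] x src_id tgt_id by auto
    have "f = gcomp G (gcomp G (ginv G e) e) f"
      using inv_left[OF e] id_left[OF f] t by simp
    also have "\<dots> = gcomp G (ginv G e) (gcomp G e f)"
      using comp_assoc[OF inv_closed[OF e] e f tgt_inv[OF e] t] .
    also have "\<dots> = ginv G e"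
      using id_right[OF inv_closed[OF e]] tgt_inv[OF e] x \<open>x = src G e\<close> by simp
    finally show "f = ginv G e" .
  qed
  then show ?thesis
    using assms s comp_closed[OF e f t]
    by (auto simp: ij ccomposable_def cedges_def ccomp_def cinv_def G_def)
qed

lemma ccomp_closed: "ccomposable M W i j \<Longrightarrow> ccomp W i j \<in> cedges M W"
  by (metis ccomposable_def ccomposable_iff)

lemma csrc_ccomp: "ccomposable M W i j \<Longrightarrow> csrc W (ccomp W i j) = csrc W i"
  and ctgt_ccomp: "ccomposable M W i j \<Longrightarrow> ctgt W (ccomp W i j) = ctgt W j"
  using groupoid.src_comp[OF panel_groupoid] groupoid.tgt_comp[OF panel_groupoid]
  by (auto simp: ccomposable_def cedges_def csrc_def ctgt_def ccomp_def)

section \<open>Galleries, cycles and their ends\<close>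

lemma gallery_from_start: "gallery_from M W us C \<Longrightarrow> C \<in> chambers W"
  by (cases us) auto

lemma gallery_from_end: "gallery_from M W us C \<Longrightarrow> gend W (C, us) \<in> chambers W"
  by (induction us arbitrary: C) auto

lemma gallery_from_append [simp]:
  "gallery_from M W (us @ vs) C \<longleftrightarrow> gallery_from M W us C \<and> gallery_from M W vs (gend W (C, us))"
  by (induction us arbitrary: C) (auto dest: gallery_from_start)

text \<open>Off-diagonal entries of a Coxeter matrix are at least 2, so the type of such a cycle has
  at least four letters. Being non-empty, its edge list fixes its initial chamber.\<close>

lemma st_cycle_nonempty: "st_cycle M W s t (D, ds) \<Longrightarrow> ds \<noteq> []"
proof
  assume a: "st_cycle M W s t (D, ds)" and "ds = []"
  then have "alt_word (2 * the_enat (entry M s t)) s t = []"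
    by (simp add: st_cycle_def gtype_def)
  then have "the_enat (entry M s t) = 0"
    by (cases "2 * the_enat (entry M s t)") auto
  \<comment> \<open>Finiteness is needed for \<open>the_enat\<close> to return the entry itself
    rather than an unspecified number.\<close>
  moreover have "entry M s t \<ge> 2" "entry M s t < \<infinity>"
    using a coxeter by (auto simp: st_cycle_def finite_pair_def coxeter_matrix_def)
  ultimately show False by (cases "entry M s t") (auto simp: numeral_eq_enat)
qed

lemma defining_suite_cycle:
  assumes "(D, ds) \<in> defining_suites M W"
  shows "ds \<noteq> []" "gallery_from M W ds D" "gend W (D, ds) = D"
    "\<exists>s t. st_cycle M W s t (D, ds)"
proof -
  obtain s t where "st_cycle M W s t (D, ds)"
    using assms weyl unfolding defining_suites_def weyl_data_def by blast
  then show "ds \<noteq> []" "gallery_from M W ds D" "gend W (D, ds) = D"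
    "\<exists>s t. st_cycle M W s t (D, ds)"
    using st_cycle_nonempty by (auto simp: st_cycle_def cycle_def gallery_def gstart_def)
qed

text \<open>The source of the first edge decides. The rule \<open>delete_suite\<close> does not say
  that the chamber \<open>D\<close> of a suite is the chamber reached by \<open>us\<close>; this
  fact recovers it.\<close>

lemma gallery_from_unique_start:
  "gallery_from M W us C \<Longrightarrow> gallery_from M W us D \<Longrightarrow> us \<noteq> [] \<Longrightarrow> C = D"
  by (cases us) auto

text \<open>The rules ask only that the longer side be a gallery. The ends survive because
  composites have the outer ends of their factors and what is deleted is a closed
  subgallery.\<close>

lemma elementary_homotopy_gallery:
  assumes "elementary_homotopy M W \<beta> \<gamma>"
  shows "gallery M W \<beta> \<and> gallery M W \<gamma> \<and> fst \<gamma> = fst \<beta> \<and> gend W \<gamma> = gend W \<beta>"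
  using assms
proof cases
  case (delete_inverse C us i vs)
  then show ?thesis by (auto simp: gallery_def dest: gallery_from_end)
next
  case (compose_edges C us i j vs)
  then show ?thesis by (auto simp: gallery_def ccomp_closed csrc_ccomp ctgt_ccomp)
next
  case (delete_suite C us ds vs D)
  then have "gend W (C, us) = D"
    using gallery_from_unique_start defining_suite_cycle[OF delete_suite(4)]
    by (auto simp: gallery_def)
  then show ?thesis using delete_suite defining_suite_cycle[OF delete_suite(4)]
    by (auto simp: gallery_def)
qed

section \<open>Homotopy as a congruence for concatenation\<close>

lemma homotopic_refl: "gallery M W \<beta> \<Longrightarrow> homotopic M W \<beta> \<beta>"
  by (simp add: homotopic_def)

lemma homotopic_sym: "homotopic M W \<beta> \<gamma> \<Longrightarrow> homotopic M W \<gamma> \<beta>"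
  by (auto simp: homotopic_def intro: equivclp_sym)

lemma homotopic_trans: "homotopic M W \<beta> \<gamma> \<Longrightarrow> homotopic M W \<gamma> \<delta> \<Longrightarrow> homotopic M W \<beta> \<delta>"
  by (auto simp: homotopic_def intro: equivclp_trans)

lemma elementary_homotopy_homotopic: "elementary_homotopy M W \<beta> \<gamma> \<Longrightarrow> homotopic M W \<beta> \<gamma>"
  using elementary_homotopy_gallery by (auto simp: homotopic_def)

text \<open>Separates moves from inverse moves and records at each stage that the gallery reached is
  homotopic to the first one, hence a gallery with the same ends.\<close>

lemma homotopic_induct [consumes 1, case_names refl step unstep]:
  assumes "homotopic M W \<beta> \<gamma>" and "P \<beta>"
    and "\<And>\<delta> \<epsilon>. \<lbrakk>homotopic M W \<beta> \<delta>; elementary_homotopy M W \<delta> \<epsilon>; P \<delta>\<rbrakk> \<Longrightarrow> P \<epsilon>"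
    and "\<And>\<delta> \<epsilon>. \<lbrakk>homotopic M W \<beta> \<delta>; elementary_homotopy M W \<epsilon> \<delta>; P \<delta>\<rbrakk> \<Longrightarrow> P \<epsilon>"
  shows "P \<gamma>"
proof -
  have g: "gallery M W \<beta>" and "equivclp (elementary_homotopy M W) \<beta> \<gamma>"
    using assms(1) by (auto simp: homotopic_def)
  from this(2) have "homotopic M W \<beta> \<gamma> \<and> P \<gamma>"
  proof (induction rule: equivclp_induct)
    case base
    then show ?case using g assms(2) by (simp add: homotopic_refl)
  next
    case (step y z)
    then show ?case
      using assms(3,4) elementary_homotopy_homotopic homotopic_trans homotopic_sym by blast
  qed
  then show ?thesis by blast
qed

lemma homotopic_ends:
  "homotopic M W \<beta> \<gamma> \<Longrightarrow> fst \<gamma> = fst \<beta> \<and> gend W \<gamma> = gend W \<beta>"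
  by (induction rule: homotopic_induct) (auto dest: elementary_homotopy_gallery)

text \<open>A move happens inside a list with arbitrary prefix and suffix, so \<open>ps\<close> and
  \<open>bs\<close> are absorbed into these.\<close>

lemma elementary_homotopy_context:
  assumes "elementary_homotopy M W (D, us) (D, us')"
    and "gallery_from M W ps C" "gend W (C, ps) = D" "gallery_from M W bs (gend W (D, us))"
  shows "elementary_homotopy M W (C, ps @ us @ bs) (C, ps @ us' @ bs)"
  using assms(1)
proof cases
  case (delete_inverse xs i ys)
  then show ?thesis
    using elementary_homotopy.delete_inverse[of M W C "ps @ xs" i "ys @ bs"] assms
    by (auto simp: gallery_def)
next
  case (compose_edges xs i j ys)
  then show ?thesis
    using elementary_homotopy.compose_edges[of M W C "ps @ xs" i j "ys @ bs"] assms
    by (auto simp: gallery_def)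
next
  case (delete_suite xs ds ys E)
  then show ?thesis
    using elementary_homotopy.delete_suite[of M W C "ps @ xs" ds "ys @ bs" E] assms
    by (auto simp: gallery_def)
qed

lemma homotopic_context:
  assumes "homotopic M W (D, us) (D, us')"
    and "gallery_from M W ps C" "gend W (C, ps) = D" "gallery_from M W bs (gend W (D, us))"
  shows "homotopic M W (C, ps @ us @ bs) (C, ps @ us' @ bs)"
proof -
  \<comment> \<open>Only the edge list of an intermediate gallery enters; its initial chamber stays
    \<open>D\<close>, because homotopies preserve ends.\<close>
  define Q where "Q \<delta> \<longleftrightarrow> homotopic M W (C, ps @ us @ bs) (C, ps @ snd \<delta> @ bs)" for \<delta> :: "('s,'c,'e) gal"
  have *: "elementary_homotopy M W (C, ps @ snd \<delta> @ bs) (C, ps @ snd \<epsilon> @ bs)"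
    if "elementary_homotopy M W \<delta> \<epsilon>" "fst \<delta> = D" "gend W \<delta> = gend W (D, us)" for \<delta> \<epsilon>
    using elementary_homotopy_context[of D "snd \<delta>" "snd \<epsilon>" ps C bs] assms that
      elementary_homotopy_gallery[OF that(1)] by (cases \<delta>; cases \<epsilon>) auto
  from assms(1) have "Q (D, us')"
  proof (induction rule: homotopic_induct)
    case refl
    show ?case using assms by (auto simp: Q_def homotopic_def gallery_def)
  next
    case (step \<delta> \<epsilon>)
    then have "elementary_homotopy M W (C, ps @ snd \<delta> @ bs) (C, ps @ snd \<epsilon> @ bs)"
      using *[OF step(2)] homotopic_ends[OF step(1)] by simp
    then show ?case
      using step(3) homotopic_trans elementary_homotopy_homotopic unfolding Q_def by blast
  next
    case (unstep \<delta> \<epsilon>)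
    then have "elementary_homotopy M W (C, ps @ snd \<epsilon> @ bs) (C, ps @ snd \<delta> @ bs)"
      using *[OF unstep(2)] homotopic_ends[OF unstep(1)] elementary_homotopy_gallery[OF unstep(2)]
      by simp
    then show ?case
      using unstep(3) homotopic_trans elementary_homotopy_homotopic homotopic_sym
      unfolding Q_def by blast
  qed
  then show ?thesis by (simp add: Q_def)
qed

text \<open>Extends \<open>delete_suite\<close> from defining suites to all suites by contracting
  the suite in context. This is needed because morphisms send defining suites to suites that may
  fail to be defining.\<close>

lemma suite_delete:
  assumes "suite M W (D, ds)" "gallery M W (C, us @ ds @ vs)"
  shows "homotopic M W (C, us @ ds @ vs) (C, us @ vs)"
proof -
  obtain E where E: "homotopic M W (D, ds) (E, [])" and "ds \<noteq> []"
    using assms st_cycle_nonempty by (auto simp: suite_def)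
  \<comment> \<open>The chamber to which a suite contracts is arbitrary in the definition;
    preservation of the initial chamber identifies it.\<close>
  then have [simp]: "E = D" and "gend W (D, ds) = D" "gallery_from M W ds D"
    using homotopic_ends[OF E] by (auto simp: homotopic_def gallery_def)
  moreover have "gend W (C, us) = D"
    using assms \<open>ds \<noteq> []\<close> \<open>gallery_from M W ds D\<close> gallery_from_unique_start
    by (auto simp: gallery_def)
  ultimately show ?thesis
    using homotopic_context[of D ds "[]" us C vs] E assms by (auto simp: gallery_def)
qed

section \<open>Homotopy classes and chosen representatives\<close>

lemma hclass_eq_iff:
  "gallery M W \<beta> \<Longrightarrow> hclass M W \<beta> = hclass M W \<gamma> \<longleftrightarrow> homotopic M W \<beta> \<gamma>"
  unfolding hclass_def using homotopic_refl homotopic_sym homotopic_trans by blast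

text \<open>By reflexivity the class is non-empty, so the choice made by \<open>hrep\<close> lies in
  it.\<close>

lemma hrep_hclass: "gallery M W \<beta> \<Longrightarrow> homotopic M W \<beta> (hrep (hclass M W \<beta>))"
  unfolding hrep_def using someI[of "\<lambda>\<gamma>. \<gamma> \<in> hclass M W \<beta>" \<beta>] homotopic_refl
  by (auto simp: hclass_def)

lemma fundamental_edge:
  assumes "X \<in> edges (fundamental_groupoid M W)"
  shows "gallery M W (hrep X)" "hclass M W (hrep X) = X"
proof -
  obtain \<beta> where \<beta>: "gallery M W \<beta>" "X = hclass M W \<beta>"
    using assms by (auto simp: fundamental_groupoid_def)
  then have "homotopic M W \<beta> (hrep X)" using hrep_hclass by blast
  with \<beta> show "gallery M W (hrep X)" "hclass M W (hrep X) = X"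
    using hclass_eq_iff[of \<beta> "hrep X"] by (simp_all add: homotopic_def)
qed

end

section \<open>Action of a morphism on galleries and homotopies\<close>

locale weyl_map = dom: weyl_system M V + cod: weyl_system M W
  for M :: "'s coxmat" and V :: "('s, 'c1, 'e1) weyl_data_rec" and W :: "('s, 'c, 'e) weyl_data_rec" +
  fixes \<omega> :: "('s, 'c1, 'e1, 'c, 'e) cmap"
  assumes morphism: "weyl_morphism M V W \<omega>"
begin

lemma chamber_morphism: "chamber_morphism M V W \<omega>"
  using morphism by (simp add: weyl_morphism_def)

lemma vmap_closed: "C \<in> chambers V \<Longrightarrow> vmap \<omega> C \<in> chambers W"
  and emap_closed: "i \<in> cedges M V \<Longrightarrow> emap \<omega> i \<in> cedges M W"
  and emap_src: "i \<in> cedges M V \<Longrightarrow> csrc W (emap \<omega> i) = vmap \<omega> (csrc V i)"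
  and emap_tgt: "i \<in> cedges M V \<Longrightarrow> ctgt W (emap \<omega> i) = vmap \<omega> (ctgt V i)"
  and emap_type: "i \<in> cedges M V \<Longrightarrow> fst (emap \<omega> i) = fst i"
  and emap_inv: "i \<in> cedges M V \<Longrightarrow> emap \<omega> (cinv V i) = cinv W (emap \<omega> i)"
  using chamber_morphism by (auto simp: chamber_morphism_def)

lemma emap_comp: "ccomposable M V i j \<Longrightarrow> emap \<omega> (ccomp V i j) = ccomp W (emap \<omega> i) (emap \<omega> j)"
  using chamber_morphism unfolding chamber_morphism_def by blast

lemma gallery_from_map:
  "gallery_from M V us C \<Longrightarrow>
    gallery_from M W (map (emap \<omega>) us) (vmap \<omega> C) \<and>
    gend W (vmap \<omega> C, map (emap \<omega>) us) = vmap \<omega> (gend V (C, us))"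
  by (induction us arbitrary: C) (auto simp: vmap_closed emap_closed emap_src emap_tgt)

lemma gallery_map: "gallery M V \<beta> \<Longrightarrow> gallery M W (map_gallery \<omega> \<beta>)"
  using gallery_from_map by (simp add: gallery_def map_gallery_def)

text \<open>An inequality \<open>j \<noteq> cinv V i\<close> need not survive a non-injective map.
  Here it does, since the image of the composite is an edge and therefore not an identity.\<close>

lemma ccomposable_map:
  assumes "ccomposable M V i j"
  shows "ccomposable M W (emap \<omega> i) (emap \<omega> j)"
proof -
  have "i \<in> cedges M V" "j \<in> cedges M V" "fst i = fst j" "ctgt V i = csrc V j"
    using assms by (auto simp: ccomposable_def)
  moreover have "ccomp W (emap \<omega> i) (emap \<omega> j) \<in> cedges M W"
    using emap_comp[OF assms] emap_closed[OF dom.ccomp_closed[OF assms]] by simp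
  ultimately show ?thesis
    using cod.ccomposable_iff by (simp add: emap_closed emap_src emap_tgt emap_type)
qed

text \<open>The first two kinds of move go to moves of the same kind. A defining suite goes to a
  suite, whose deletion may take several moves; hence the conclusion is a homotopy.\<close>

lemma elementary_homotopy_map:
  assumes "elementary_homotopy M V \<beta> \<gamma>"
  shows "homotopic M W (map_gallery \<omega> \<beta>) (map_gallery \<omega> \<gamma>)"
  using assms
proof cases
  case (delete_inverse C us i vs)
  then have "i \<in> cedges M V" by (simp add: gallery_def)
  then show ?thesis
    using delete_inverse gallery_map[OF delete_inverse(3)] cod.elementary_homotopy_homotopic
      elementary_homotopy.delete_inverse[of M W "vmap \<omega> C" "map (emap \<omega>) us" "emap \<omega> i" "map (emap \<omega>) vs"]
    by (simp add: map_gallery_def emap_inv)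
next
  case (compose_edges C us i j vs)
  then show ?thesis
    using gallery_map[OF compose_edges(3)] cod.elementary_homotopy_homotopic ccomposable_map
      elementary_homotopy.compose_edges[of M W "vmap \<omega> C" "map (emap \<omega>) us" "emap \<omega> i" "emap \<omega> j" "map (emap \<omega>) vs"]
    by (simp add: map_gallery_def emap_comp)
next
  case (delete_suite C us ds vs D)
  then have "suite M W (map_gallery \<omega> (D, ds))"
    using morphism by (auto simp: weyl_morphism_def)
  then show ?thesis
    using delete_suite gallery_map[OF delete_suite(3)]
      cod.suite_delete[of "vmap \<omega> D" "map (emap \<omega>) ds" "vmap \<omega> C" "map (emap \<omega>) us" "map (emap \<omega>) vs"]
    by (simp add: map_gallery_def)
qed

lemma homotopic_map:
  assumes "homotopic M V \<beta> \<gamma>"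
  shows "homotopic M W (map_gallery \<omega> \<beta>) (map_gallery \<omega> \<gamma>)"
  using assms
proof (induction rule: dom.homotopic_induct)
  case refl
  show ?case using assms by (simp add: homotopic_def gallery_map)
next
  case (step \<delta> \<epsilon>)
  then show ?case using elementary_homotopy_map cod.homotopic_trans by blast
next
  case (unstep \<delta> \<epsilon>)
  then show ?case using elementary_homotopy_map cod.homotopic_trans cod.homotopic_sym by blast
qed

end

section \<open>Lifting of galleries and homotopies through a covering\<close>

locale weyl_covering =
  fixes M :: "'s coxmat" and V :: "('s, 'c1, 'e1) weyl_data_rec" and W :: "('s, 'c, 'e) weyl_data_rec"
    and \<omega> :: "('s, 'c1, 'e1, 'c, 'e) cmap"
  assumes coxeter: "coxeter_matrix M" and covering: "covering M V W \<omega>"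

sublocale weyl_covering \<subseteq> weyl_map
  using coxeter covering by unfold_locales (auto simp: covering_def)

context weyl_covering
begin

lemma edge_unique:
  "\<lbrakk>i \<in> cedges M V; j \<in> cedges M V; csrc V i = csrc V j; emap \<omega> i = emap \<omega> j\<rbrakk> \<Longrightarrow> i = j"
proof -
  assume ij: "i \<in> cedges M V" "j \<in> cedges M V" "csrc V i = csrc V j" "emap \<omega> i = emap \<omega> j"
  then have "inj_on (emap \<omega>) {k \<in> cedges M V. csrc V k = csrc V j}"
    using covering by (auto simp: covering_def surjective_etale_def bij_betw_def)
  with ij show ?thesis by (auto dest: inj_onD)
qed

lemma edge_lift:
  assumes "C \<in> chambers V" "k \<in> cedges M W" "csrc W k = vmap \<omega> C"
  shows "\<exists>!i. i \<in> cedges M V \<and> csrc V i = C \<and> emap \<omega> i = k"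
proof -
  have "emap \<omega> ` {i \<in> cedges M V. csrc V i = C} = {i \<in> cedges M W. csrc W i = vmap \<omega> C}"
    using covering assms by (auto simp: covering_def surjective_etale_def bij_betw_def)
  moreover have "k \<in> {i \<in> cedges M W. csrc W i = vmap \<omega> C}" using assms by simp
  ultimately have "k \<in> emap \<omega> ` {i \<in> cedges M V. csrc V i = C}" by simp
  then obtain i where i: "i \<in> cedges M V" "csrc V i = C" "emap \<omega> i = k" by auto
  then show ?thesis
  proof (intro ex1I[of _ i] conjI)
    fix j assume "j \<in> cedges M V \<and> csrc V j = C \<and> emap \<omega> j = k"
    with i show "j = i" by (intro edge_unique) simp_all
  qed
qed

text \<open>Edges are lifted one after the other: the lifted edge ends above the end of
  \<open>k\<close>, and the next edge is lifted from there.\<close>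

lemma gallery_lift:
  "C \<in> chambers V \<Longrightarrow> gallery_from M W us (vmap \<omega> C) \<Longrightarrow>
    \<exists>us'. gallery_from M V us' C \<and> map (emap \<omega>) us' = us"
proof (induction us arbitrary: C)
  case (Cons k us)
  then obtain i where i: "i \<in> cedges M V" "csrc V i = C" "emap \<omega> i = k"
    using edge_lift[of C k] by auto
  have "ctgt V i \<in> chambers V" "gallery_from M W us (vmap \<omega> (ctgt V i))"
    using Cons.prems i emap_tgt[of i] by auto
  then obtain us' where "gallery_from M V us' (ctgt V i)" "map (emap \<omega>) us' = us"
    using Cons.IH by blast
  with i have "gallery_from M V (i # us') C" "map (emap \<omega>) (i # us') = k # us" by simp_all
  then show ?case by (intro exI conjI)
qed simp

lemma gallery_lift_unique:
  "gallery_from M V us C \<Longrightarrow> gallery_from M V us' C \<Longrightarrow>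
    map (emap \<omega>) us = map (emap \<omega>) us' \<Longrightarrow> us = us'"
proof (induction us arbitrary: us' C)
  case (Cons i us)
  then obtain j vs where "us' = j # vs" by (cases us') auto
  with Cons edge_unique[of i j] show ?case by auto
qed simp

text \<open>The edge list of \<open>\<beta>\<close> is cut where its image is cut, and the pattern
  of the move is recognised in the lifted pieces. Only shortening moves are treated;
  \<open>homotopic_lift\<close> reduces inverse moves to them.\<close>

lemma elementary_homotopy_lift:
  assumes "elementary_homotopy M W (map_gallery \<omega> \<beta>) \<gamma>" and \<beta>: "gallery M V \<beta>"
  shows "\<exists>\<gamma>'. homotopic M V \<beta> \<gamma>' \<and> map_gallery \<omega> \<gamma>' = \<gamma>"
proof -
  obtain C xs where \<beta>_eq: "\<beta> = (C, xs)" by force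
  have xs: "gallery_from M V xs C" using \<beta> by (simp add: \<beta>_eq gallery_def)
  from assms(1) show ?thesis
  proof cases
    case (delete_inverse C' us i vs)
    then have eq: "C' = vmap \<omega> C" "map (emap \<omega>) xs = us @ [i, cinv W i] @ vs"
      by (auto simp: \<beta>_eq map_gallery_def)
    then obtain us' j k vs' where l: "xs = us' @ [j, k] @ vs'"
      "map (emap \<omega>) us' = us" "map (emap \<omega>) vs' = vs" "emap \<omega> j = i" "emap \<omega> k = cinv W i"
      by (fastforce simp: map_eq_append_conv map_eq_Cons_conv)
    \<comment> \<open>Both edges issue from the terminal chamber of \<open>j\<close> and lie above
      \<open>cinv W i\<close>.\<close>
    then have "k = cinv V j" using xs by (intro edge_unique) (auto simp: emap_inv)
    then have "homotopic M V \<beta> (C, us' @ vs')"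
      using \<beta> l(1) unfolding \<beta>_eq
      by (auto intro!: dom.elementary_homotopy_homotopic elementary_homotopy.delete_inverse[simplified])
    then show ?thesis using delete_inverse eq l
      by (intro exI[of _ "(C, us' @ vs')"]) (simp add: map_gallery_def)
  next
    case (compose_edges C' us i j vs)
    then have eq: "C' = vmap \<omega> C" "map (emap \<omega>) xs = us @ [i, j] @ vs"
      by (auto simp: \<beta>_eq map_gallery_def)
    then obtain us' i' j' vs' where l: "xs = us' @ [i', j'] @ vs'"
      "map (emap \<omega>) us' = us" "map (emap \<omega>) vs' = vs" "emap \<omega> i' = i" "emap \<omega> j' = j"
      by (fastforce simp: map_eq_append_conv map_eq_Cons_conv)
    then have e: "i' \<in> cedges M V" "j' \<in> cedges M V" "ctgt V i' = csrc V j'" using xs by auto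
    \<comment> \<open>If \<open>j'\<close> were inverse to \<open>i'\<close>, then \<open>j\<close>
      would be inverse to \<open>i\<close>.\<close>
    then have c: "ccomposable M V i' j'"
      using compose_edges(4) emap_type[of i'] emap_type[of j'] emap_inv[of i'] l
      by (auto simp: ccomposable_def)
    then have "homotopic M V \<beta> (C, us' @ [ccomp V i' j'] @ vs')"
      using \<beta> l(1) unfolding \<beta>_eq
      by (metis dom.elementary_homotopy_homotopic elementary_homotopy.compose_edges)
    then show ?thesis using compose_edges eq l emap_comp[OF c]
      by (intro exI[of _ "(C, us' @ [ccomp V i' j'] @ vs')"]) (simp add: map_gallery_def)
  next
    case (delete_suite C' us ds vs D)
    then have eq: "C' = vmap \<omega> C" "map (emap \<omega>) xs = us @ ds @ vs"
      by (auto simp: \<beta>_eq map_gallery_def)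
    from eq(2) obtain us' ws where us': "xs = us' @ ws" "us = map (emap \<omega>) us'"
      and ws: "ds @ vs = map (emap \<omega>) ws"
      unfolding map_eq_append_conv by blast
    from ws obtain ds' vs' where "ws = ds' @ vs'" "ds = map (emap \<omega>) ds'" "vs = map (emap \<omega>) vs'"
      unfolding append_eq_map_conv by blast
    with us' have l: "xs = us' @ ds' @ vs'"
      "map (emap \<omega>) us' = us" "map (emap \<omega>) ds' = ds" "map (emap \<omega>) vs' = vs"
      by auto
    \<comment> \<open>That \<open>ds'\<close> closes up is not known in advance. It comes from the
      covering condition, which asks for a gallery above \<open>(D, ds)\<close>, so
      \<open>D'\<close> must be shown to lie above \<open>D\<close>.\<close>
    define D' where "D' = gend V (C, us')"
    have ds': "gallery_from M V ds' D'" using xs l by (simp add: D'_def)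
    then have "vmap \<omega> D' = D"
      using gallery_from_map[OF ds'] cod.defining_suite_cycle[OF delete_suite(4)]
        cod.gallery_from_unique_start l by blast
    then have "suite M V (D', ds')"
      using covering ds' l delete_suite(4)
      by (auto simp: covering_def gallery_def map_gallery_def)
    then have "homotopic M V \<beta> (C, us' @ vs')"
      using dom.suite_delete \<beta> l(1) by (auto simp: \<beta>_eq)
    then show ?thesis using delete_suite eq l
      by (intro exI[of _ "(C, us' @ vs')"]) (simp add: map_gallery_def)
  qed
qed

lemma gallery_unique:
  assumes "gallery M V \<beta>" "gallery M V \<gamma>" "fst \<beta> = fst \<gamma>" "map_gallery \<omega> \<beta> = map_gallery \<omega> \<gamma>"
  shows "\<beta> = \<gamma>"
  using assms gallery_lift_unique[of "snd \<beta>" "fst \<beta>" "snd \<gamma>"]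
  by (simp add: prod_eq_iff gallery_def map_gallery_def)

text \<open>The homotopy in the base is followed by galleries homotopic to \<open>\<beta>\<close>.
  The last of them has the initial chamber and the image of \<open>\<gamma>\<close>, so unique
  lifting makes it equal to \<open>\<gamma>\<close>.\<close>

lemma homotopic_lift:
  assumes "homotopic M W (map_gallery \<omega> \<beta>) (map_gallery \<omega> \<gamma>)"
    and \<beta>: "gallery M V \<beta>" and "gallery M V \<gamma>" and "fst \<gamma> = fst \<beta>"
  shows "homotopic M V \<beta> \<gamma>"
proof -
  have "\<exists>\<gamma>'. homotopic M V \<beta> \<gamma>' \<and> map_gallery \<omega> \<gamma>' = \<delta>"
    if "homotopic M W (map_gallery \<omega> \<beta>) \<delta>" for \<delta>
    using that
  proof (induction rule: cod.homotopic_induct)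
    case refl
    then show ?case using \<beta> dom.homotopic_refl by blast
  next
    case (step \<delta> \<epsilon>)
    then show ?case
      using elementary_homotopy_lift dom.homotopic_trans by (metis homotopic_def)
  next
    case (unstep \<delta> \<epsilon>)
    then obtain \<delta>' where \<delta>': "homotopic M V \<beta> \<delta>'" "map_gallery \<omega> \<delta>' = \<delta>" by blast
    \<comment> \<open>For an inverse move the longer gallery \<open>\<epsilon>\<close> is lifted
      first. The move is then applied to its lift, and the result is the gallery
      \<open>\<delta>'\<close> already reached, by unique lifting.\<close>
    have \<epsilon>: "gallery_from M W (snd \<epsilon>) (vmap \<omega> (fst \<beta>))" and f: "fst \<epsilon> = vmap \<omega> (fst \<beta>)"
      using cod.elementary_homotopy_gallery[OF unstep(2)] cod.homotopic_ends[OF unstep(1)]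
      by (auto simp: gallery_def map_gallery_def)
    moreover have "fst \<beta> \<in> chambers V"
      using \<beta> dom.gallery_from_start by (auto simp: gallery_def)
    ultimately obtain xs where xs: "gallery_from M V xs (fst \<beta>)" "map (emap \<omega>) xs = snd \<epsilon>"
      using gallery_lift by blast
    define \<epsilon>' where "\<epsilon>' = (fst \<beta>, xs)"
    have \<epsilon>': "gallery M V \<epsilon>'" "map_gallery \<omega> \<epsilon>' = \<epsilon>" "fst \<epsilon>' = fst \<beta>"
      using xs f by (auto simp: \<epsilon>'_def gallery_def map_gallery_def prod_eq_iff)
    then obtain \<eta> where \<eta>: "homotopic M V \<epsilon>' \<eta>" "map_gallery \<omega> \<eta> = \<delta>"
      using elementary_homotopy_lift[of \<epsilon>' \<delta>] unstep(2) by auto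
    then have "\<eta> = \<delta>'"
      using \<delta>' \<epsilon>' dom.homotopic_ends[OF \<eta>(1)] dom.homotopic_ends[OF \<delta>'(1)]
      by (intro gallery_unique) (auto simp: homotopic_def)
    then show ?case using \<eta> \<delta>' \<epsilon>' dom.homotopic_trans dom.homotopic_sym by blast
  qed
  then obtain \<gamma>' where \<gamma>': "homotopic M V \<beta> \<gamma>'" "map_gallery \<omega> \<gamma>' = map_gallery \<omega> \<gamma>"
    using assms(1) by blast
  then have "\<gamma>' = \<gamma>"
    using assms dom.homotopic_ends[OF \<gamma>'(1)] by (intro gallery_unique) (auto simp: homotopic_def)
  with \<gamma>' show ?thesis by simp
qed

end

theorem proposition4p17:
  fixes M :: "'s coxmat"
    and W :: "('s, 'c, 'e) weyl_data_rec"
    and Wt :: "('s, 'c1, 'e1) weyl_data_rec"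
    and Wt' :: "('s, 'c2, 'e2) weyl_data_rec"
    and p :: "('s, 'c1, 'e1, 'c, 'e) cmap"
    and p' :: "('s, 'c2, 'e2, 'c, 'e) cmap"
    and \<Lambda> :: "('c1, 'c2, ('s, 'c1, 'e1) gal set, ('s, 'c2, 'e2) gal set) graph_map"
  assumes "coxeter_matrix M"
    and "two_weyl_graph M W"
    and "covering M Wt W p"
    and "covering M Wt' W p'"
    and "groupoid_covering_morphism (fundamental_groupoid M Wt) (fundamental_groupoid M Wt')
           (induced_hom M Wt W p) (induced_hom M Wt' W p') \<Lambda>"
  shows "\<exists>!\<mu>. covering_morphism M Wt Wt' p p' \<mu> \<and> induced_hom M Wt Wt' \<mu> = \<Lambda>"
proof -
  interpret V: weyl_covering M Wt W p
    using assms by unfold_locales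
  interpret V': weyl_covering M Wt' W p'
    using assms by unfold_locales
  let ?F = "fundamental_groupoid M Wt" and ?F' = "fundamental_groupoid M Wt'"

  \<comment> \<open>The given homomorphism on chambers and representatives\<close>
  have verts: "verts ?F = chambers Wt" "verts ?F' = chambers Wt'"
    by (simp_all add: fundamental_groupoid_def)
  have hom: "groupoid_hom ?F ?F' \<Lambda>"
    and over: "induced_hom M Wt W p = map_comp_on (verts ?F) (edges ?F) (induced_hom M Wt' W p') \<Lambda>"
    using assms(5) by (auto simp: groupoid_covering_morphism_def)
  have vL_ext: "vmap \<Lambda> \<in> chambers Wt \<rightarrow>\<^sub>E chambers Wt'"
    and eL_ext: "emap \<Lambda> \<in> edges ?F \<rightarrow>\<^sub>E edges ?F'"
    using hom by (auto simp: groupoid_hom_def verts)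
  have vL: "vmap \<Lambda> C \<in> chambers Wt'" if "C \<in> chambers Wt" for C
    using vL_ext that by auto
  have vL_over: "vmap p' (vmap \<Lambda> C) = vmap p C" if "C \<in> chambers Wt" for C
  proof -
    have "vmap (induced_hom M Wt W p) C = compose (chambers Wt) (vmap (induced_hom M Wt' W p')) (vmap \<Lambda>) C"
      using over by (simp add: map_comp_on_def verts)
    then show ?thesis using that vL by (simp add: induced_hom_def compose_def verts)
  qed
  \<comment> \<open>Representatives on the two sides are chosen independently, so their images in
    the base are known to agree only up to homotopy.\<close>
  have eL: "homotopic M W (map_gallery p (hrep X)) (map_gallery p' (hrep (emap \<Lambda> X)))"
    "emap \<Lambda> X \<in> edges ?F'"
    "fst (hrep (emap \<Lambda> X)) = vmap \<Lambda> (fst (hrep X))"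
    "gend Wt' (hrep (emap \<Lambda> X)) = vmap \<Lambda> (gend Wt (hrep X))"
    if X: "X \<in> edges ?F" for X
  proof -
    show Y: "emap \<Lambda> X \<in> edges ?F'" using X eL_ext by auto
    have "emap (induced_hom M Wt W p) X = compose (edges ?F) (emap (induced_hom M Wt' W p')) (emap \<Lambda>) X"
      using over by (simp add: map_comp_on_def)
    then have "hclass M W (map_gallery p (hrep X)) = hclass M W (map_gallery p' (hrep (emap \<Lambda> X)))"
      using X Y by (simp add: induced_hom_def compose_def)
    then show "homotopic M W (map_gallery p (hrep X)) (map_gallery p' (hrep (emap \<Lambda> X)))"
      using V.cod.hclass_eq_iff V.gallery_map V.dom.fundamental_edge(1)[OF X] by blast
    have "src ?F' (emap \<Lambda> X) = vmap \<Lambda> (src ?F X)" "tgt ?F' (emap \<Lambda> X) = vmap \<Lambda> (tgt ?F X)"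
      using hom X by (auto simp: groupoid_hom_def)
    then show "fst (hrep (emap \<Lambda> X)) = vmap \<Lambda> (fst (hrep X))"
      "gend Wt' (hrep (emap \<Lambda> X)) = vmap \<Lambda> (gend Wt (hrep X))"
      by (simp_all add: fundamental_groupoid_def gstart_def)
  qed
  have class_edge: "hclass M Wt \<beta> \<in> edges ?F" if "gallery M Wt \<beta>" for \<beta>
    using that by (auto simp: fundamental_groupoid_def simp del: split_paired_Ex)

  \<comment> \<open>Lifting single edges\<close>
  define lift where
    "lift i = (THE j. j \<in> cedges M Wt' \<and> csrc Wt' j = vmap \<Lambda> (csrc Wt i) \<and> emap p' j = emap p i)" for i
  have lift: "lift i \<in> cedges M Wt'" "csrc Wt' (lift i) = vmap \<Lambda> (csrc Wt i)"
    "emap p' (lift i) = emap p i" if i: "i \<in> cedges M Wt" for i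
  proof -
    \<comment> \<open>The chamber \<open>vmap \<Lambda> (csrc Wt i)\<close> lies above the source of
      \<open>emap p i\<close>, so the etale condition on \<open>p'\<close> applies there.\<close>
    have "\<exists>!j. j \<in> cedges M Wt' \<and> csrc Wt' j = vmap \<Lambda> (csrc Wt i) \<and> emap p' j = emap p i"
      using i by (intro V'.edge_lift) (simp_all add: vL V.emap_closed V.emap_src vL_over)
    from theI'[OF this] show "lift i \<in> cedges M Wt'" "csrc Wt' (lift i) = vmap \<Lambda> (csrc Wt i)"
      "emap p' (lift i) = emap p i" by (simp_all add: lift_def)
  qed
  have lift_type: "fst (lift i) = fst i" if "i \<in> cedges M Wt" for i
    using that lift V.emap_type V'.emap_type by metis
  have lift_unique: "j = lift i" if "i \<in> cedges M Wt" "j \<in> cedges M Wt'"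
    "csrc Wt' j = vmap \<Lambda> (csrc Wt i)" "emap p' j = emap p i" for i j
    using that lift by (intro V'.edge_unique) auto
  \<comment> \<open>Only the source of \<open>lift i\<close> is prescribed. Its end is obtained by
    lifting a homotopy along \<open>p'\<close>: the one-edge gallery on \<open>lift i\<close> is
    homotopic to the representative of the \<open>\<Lambda>\<close>-image of the class of
    \<open>i\<close>.\<close>
  have lift_tgt: "ctgt Wt' (lift i) = vmap \<Lambda> (ctgt Wt i)" if i: "i \<in> cedges M Wt" for i
  proof -
    define \<beta> where "\<beta> = (csrc Wt i, [i])"
    define \<gamma> where "\<gamma> = (vmap \<Lambda> (csrc Wt i), [lift i])"
    define X where "X = hclass M Wt \<beta>"
    have \<beta>: "gallery M Wt \<beta>" and \<gamma>: "gallery M Wt' \<gamma>"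
      using i lift by (auto simp: \<beta>_def \<gamma>_def gallery_def)
    have X: "X \<in> edges ?F" using class_edge \<beta> by (simp add: X_def)
    have r: "homotopic M Wt \<beta> (hrep X)" using V.dom.hrep_hclass \<beta> by (simp add: X_def)
    have "map_gallery p \<beta> = map_gallery p' \<gamma>"
      using i lift by (simp add: \<beta>_def \<gamma>_def map_gallery_def vL_over)
    then have "homotopic M W (map_gallery p' \<gamma>) (map_gallery p' (hrep (emap \<Lambda> X)))"
      using V.homotopic_map[OF r] eL(1)[OF X] V.cod.homotopic_trans by metis
    moreover have "fst (hrep (emap \<Lambda> X)) = fst \<gamma>"
      using eL(3)[OF X] V.dom.homotopic_ends[OF r] by (simp add: \<beta>_def \<gamma>_def)
    ultimately have "homotopic M Wt' \<gamma> (hrep (emap \<Lambda> X))"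
      using V'.homotopic_lift \<gamma> V'.dom.fundamental_edge(1)[OF eL(2)[OF X]] by blast
    then show ?thesis
      using V'.dom.homotopic_ends eL(4)[OF X] V.dom.homotopic_ends[OF r]
      by (fastforce simp: \<beta>_def \<gamma>_def)
  qed

  \<comment> \<open>The morphism of chamber systems\<close>
  define \<mu> where "\<mu> = Graph_Map (vmap \<Lambda>) (restrict lift (cedges M Wt))"
  have [simp]: "vmap \<mu> = vmap \<Lambda>" "i \<in> cedges M Wt \<Longrightarrow> emap \<mu> i = lift i" for i
    by (simp_all add: \<mu>_def)
  \<comment> \<open>The inverse starts at the end of \<open>lift i\<close>, so
    \<open>lift_tgt\<close> supplies the source required by \<open>lift_unique\<close>.\<close>
  have lift_inv: "lift (cinv Wt i) = cinv Wt' (lift i)" if "i \<in> cedges M Wt" for i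
    using that lift lift_tgt
    by (intro lift_unique[symmetric]) (auto simp: V'.emap_inv V.emap_inv)
  have lift_comp: "lift (ccomp Wt i j) = ccomp Wt' (lift i) (lift j)" if c: "ccomposable M Wt i j" for i j
  proof -
    have ij: "i \<in> cedges M Wt" "j \<in> cedges M Wt" "ctgt Wt i = csrc Wt j" "fst i = fst j" "j \<noteq> cinv Wt i"
      using c by (auto simp: ccomposable_def)
    \<comment> \<open>An equality here would project to the base, where \<open>j\<close> and
      \<open>cinv Wt i\<close> would have the same image; they issue from the same chamber, so local
      injectivity of \<open>p\<close> would identify them.\<close>
    have "lift j \<noteq> cinv Wt' (lift i)"
    proof
      assume "lift j = cinv Wt' (lift i)"
      then have "emap p j = emap p (cinv Wt i)" using ij lift lift_inv by (metis V.dom.cinv_closed)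
      then show False using ij V.edge_unique[of j "cinv Wt i"] by simp
    qed
    then have c': "ccomposable M Wt' (lift i) (lift j)"
      using ij lift lift_tgt lift_type by (simp add: ccomposable_def)
    show ?thesis
      using lift ij V.dom.ccomp_closed[OF c] V'.dom.ccomp_closed[OF c'] V.dom.csrc_ccomp[OF c]
        V'.dom.csrc_ccomp[OF c'] V.emap_comp[OF c] V'.emap_comp[OF c']
      by (intro lift_unique[symmetric]) auto
  qed
  have cm: "chamber_morphism M Wt Wt' \<mu>"
    unfolding chamber_morphism_def
  proof (intro conjI ballI allI impI)
    show "vmap \<mu> \<in> chambers Wt \<rightarrow>\<^sub>E chambers Wt'" using vL_ext by simp
    show "emap \<mu> \<in> cedges M Wt \<rightarrow>\<^sub>E cedges M Wt'" using lift by (auto simp: \<mu>_def)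
  next
    fix i assume i: "i \<in> cedges M Wt"
    then show "csrc Wt' (emap \<mu> i) = vmap \<mu> (csrc Wt i)" "ctgt Wt' (emap \<mu> i) = vmap \<mu> (ctgt Wt i)"
      "emap \<mu> (cinv Wt i) = cinv Wt' (emap \<mu> i)"
      using lift lift_tgt lift_inv by auto
    show "fst (emap \<mu> i) = fst i" using i lift_type by simp
  next
    fix i j assume c: "ccomposable M Wt i j"
    then show "emap \<mu> (ccomp Wt i j) = ccomp Wt' (emap \<mu> i) (emap \<mu> j)"
      using lift_comp V.dom.ccomp_closed[OF c] by (auto simp: ccomposable_def)
  qed
  \<comment> \<open>Shown by hand, since \<open>weyl_map\<close> can be used for
    \<open>\<mu>\<close> only after suites are known to go to suites. The types are included in
    order to transport \<open>st_cycle\<close>.\<close>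
  have map_mu: "gallery_from M Wt' (map (emap \<mu>) us) (vmap \<mu> C) \<and>
      gend Wt' (vmap \<mu> C, map (emap \<mu>) us) = vmap \<mu> (gend Wt (C, us)) \<and>
      map (emap p') (map (emap \<mu>) us) = map (emap p) us \<and> map fst (map (emap \<mu>) us) = map fst us"
    if "gallery_from M Wt us C" for us C
    using that cm by (induction us arbitrary: C) (auto simp: vL lift chamber_morphism_def)
  have gal_mu: "gallery M Wt' (map_gallery \<mu> \<beta>)" "map_gallery p' (map_gallery \<mu> \<beta>) = map_gallery p \<beta>"
    if "gallery M Wt \<beta>" for \<beta>
    using that map_mu V.dom.gallery_from_start vL_over
    by (auto simp: gallery_def map_gallery_def)

  \<comment> \<open>Images of defining suites\<close>
  have "suite M Wt' (map_gallery \<mu> \<beta>)" if \<beta>: "\<beta> \<in> defining_suites M Wt" for \<beta>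
  proof -
    obtain D ds where [simp]: "\<beta> = (D, ds)" by force
    note c = V.dom.defining_suite_cycle[OF \<beta>[simplified]]
    have D: "D \<in> chambers Wt" using c V.dom.gallery_from_start by blast
    have g: "gallery M Wt \<beta>" using c by (simp add: gallery_def)
    obtain s t where "st_cycle M Wt s t (D, ds)" using c by blast
    then have "st_cycle M Wt' s t (map_gallery \<mu> \<beta>)"
      using map_mu[OF c(2)] c(3)
      by (simp add: st_cycle_def cycle_def gallery_def gstart_def map_gallery_def gtype_def)
    \<comment> \<open>The image of \<open>\<beta>\<close> in the base contracts because
      \<open>p\<close> is a morphism; this contraction is lifted along \<open>p'\<close>.\<close>
    moreover have "suite M W (map_gallery p \<beta>)"
      using V.morphism \<beta> by (auto simp: weyl_morphism_def)
    then obtain E where E: "homotopic M W (map_gallery p \<beta>) (E, [])" by (auto simp: suite_def)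
    then have "E = vmap p D" using V.cod.homotopic_ends[OF E] by (simp add: map_gallery_def)
    then have "homotopic M W (map_gallery p' (map_gallery \<mu> \<beta>)) (map_gallery p' (vmap \<Lambda> D, []))"
      using E vL_over[OF D] unfolding gal_mu(2)[OF g] by (simp add: map_gallery_def)
    then have "homotopic M Wt' (map_gallery \<mu> \<beta>) (vmap \<Lambda> D, [])"
      using gal_mu[OF g] vL[OF D]
      by (intro V'.homotopic_lift) (auto simp: gallery_def map_gallery_def)
    ultimately show ?thesis using vL[OF D] by (auto simp: suite_def)
  qed
  then have wm: "weyl_morphism M Wt Wt' \<mu>" using cm by (simp add: weyl_morphism_def)
  \<comment> \<open>Equality with the composite is equality of HOL functions, so agreement off the
    domain has to be checked too.\<close>
  have p_ext: "vmap p \<in> extensional (chambers Wt)" "emap p \<in> extensional (cedges M Wt)"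
    using V.chamber_morphism by (auto simp: chamber_morphism_def PiE_def)
  have "p = map_comp_on (chambers Wt) (cedges M Wt) p' \<mu>"
    unfolding map_comp_on_def
    by (intro graph_map.expand)
      (auto intro!: extensionalityI[OF p_ext(1)] extensionalityI[OF p_ext(2)]
        simp: compose_def vL_over lift)
  with wm have morph: "covering_morphism M Wt Wt' p p' \<mu>" by (simp add: covering_morphism_def)

  \<comment> \<open>The induced homomorphism\<close>
  have "hclass M Wt' (map_gallery \<mu> (hrep X)) = emap \<Lambda> X" if X: "X \<in> edges ?F" for X
  proof -
    note g = V.dom.fundamental_edge(1)[OF X]
    note h = V'.dom.fundamental_edge[OF eL(2)[OF X]]
    \<comment> \<open>Both galleries start at the \<open>\<Lambda>\<close>-image of the initial
      chamber of \<open>hrep X\<close>, and their images in the base are homotopic.\<close>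
    have "homotopic M Wt' (map_gallery \<mu> (hrep X)) (hrep (emap \<Lambda> X))"
    proof (rule V'.homotopic_lift)
      show "homotopic M W (map_gallery p' (map_gallery \<mu> (hrep X))) (map_gallery p' (hrep (emap \<Lambda> X)))"
        using eL(1)[OF X] gal_mu(2)[OF g] by simp
      show "fst (hrep (emap \<Lambda> X)) = fst (map_gallery \<mu> (hrep X))"
        using eL(3)[OF X] by (simp add: map_gallery_def)
    qed (fact gal_mu(1)[OF g] h(1))+
    then show ?thesis using V'.dom.hclass_eq_iff gal_mu[OF g] h by metis
  qed
  then have "induced_hom M Wt Wt' \<mu> = \<Lambda>"
    using vL_ext eL_ext unfolding induced_hom_def
    by (intro graph_map.expand) (auto simp: verts fun_eq_iff restrict_def PiE_def extensional_def)

  \<comment> \<open>Uniqueness\<close>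
  with morph show ?thesis
  proof (intro ex1I[of _ \<mu>])
    fix \<nu> assume \<nu>: "covering_morphism M Wt Wt' p p' \<nu> \<and> induced_hom M Wt Wt' \<nu> = \<Lambda>"
    then have cn: "chamber_morphism M Wt Wt' \<nu>"
      and pn: "p = map_comp_on (chambers Wt) (cedges M Wt) p' \<nu>"
      by (auto simp: covering_morphism_def weyl_morphism_def)
    have "vmap (induced_hom M Wt Wt' \<nu>) = vmap \<Lambda>" using \<nu> by simp
    \<comment> \<open>\<open>induced_hom\<close> restricts the chamber map to the chambers, which
      changes nothing as \<open>\<nu>\<close> is extensional. With sources known, each edge is then
      forced by its image in the base.\<close>
    then have v: "vmap \<nu> = vmap \<Lambda>"
      using cn by (simp add: induced_hom_def verts chamber_morphism_def PiE_def extensional_restrict)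
    have "emap \<nu> i = lift i" if i: "i \<in> cedges M Wt" for i
    proof (rule lift_unique[OF i])
      show "emap \<nu> i \<in> cedges M Wt'" "csrc Wt' (emap \<nu> i) = vmap \<Lambda> (csrc Wt i)"
        using i cn v by (auto simp: chamber_morphism_def)
      show "emap p' (emap \<nu> i) = emap p i"
        using i arg_cong[OF pn, of emap] by (simp add: map_comp_on_def compose_def)
    qed
    moreover have "emap \<nu> \<in> extensional (cedges M Wt)"
      using cn by (auto simp: chamber_morphism_def PiE_def)
    ultimately have "emap \<nu> = restrict lift (cedges M Wt)"
      by (auto simp: fun_eq_iff restrict_def extensional_def)
    with v show "\<nu> = \<mu>" by (simp add: \<mu>_def graph_map.expand)
  qed simp
qed

end
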